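(* Let $d\ge1$, $0<m<1$, $R>0$. Let $W(x)=\frac{|x|^2}2$ and let $\eta\in C_c^\infty(B_R)$ be a radial cut-off with $0\le\eta\le1$ and $\eta(x)=1$ if $|x|\le\frac R{\sqrt2}$. Let $V\ge 0$ be a radially symmetric and radially increasing potential satisfying the hypotheses (V1)–(V6) listed in the context, with $V(0)=0$ and $V(x)\ge2|x|^2+V_0(x)$ for a function $V_0\ge0$. Assume that $\rho\ge0$ is radial, $\int_{B_R}\rho(x)\,dx\le1$, and that for some constant $h\in\mathbb R$, $\rho$ solves on $B_R$ the Euler–Lagrange equation $$-\frac m{1-m}\rho^{m-1}(x)+V(x)+\int_{B_R}\eta(x)W(x-y)\eta(y)\rho(y)\,dy=-h .$$ Then $$\rho(x)\le\left(\frac{1-m}m V_0(x)\right)^{-\frac1{1-m}} .$$ In particular, if $\int_{B_R}\big(\frac{1-m}mV_0(x)\big)^{-\frac1{1-m}}dx<1$ then $\int_{B_R}\rho(x)\,dx<1$.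
   Context: $B_R\subset\mathbb R^d$ is the ball of radius $R$ centred at $0$. Conventions: $0^{-1/(1-m)}=+\infty$ and $(+\infty)^{m-1}=0$. Hypotheses on $V$ (with $W(x)=|x|^2/2$): (V1) $\inf_{\rho\in\mathcal P_{ac}(\mathbb R^d)}\big(\frac1{m-1}\int_{\mathbb R^d}\rho^m+\int_{\mathbb R^d}V\rho\big)>-\infty$, where $\mathcal P_{ac}$ denotes absolutely continuous probability measures; (V2) $|\nabla V(x)|\le C(1+|x|)$ for all $x\in\mathbb R^d$; (V3) $\Delta V\in L^\infty(\mathbb R^d)$; (V4) for some $\varepsilon\in(0,1)$, with infima over nonnegative absolutely continuous measures on $\mathbb R^d$ of a prescribed mass $a>0$, $\inf_\rho\big(\frac1{m-1}\int\rho^m+\int V\rho+\frac12\iint W(x-y)\rho(y)\rho(x)\,dy\,dx\big)\ge\inf_\rho\big(\frac1{m-1}\int\rho^m+(1-\varepsilon)\int V\rho\big)>-\infty$; (V5) $\lim_{\sigma\to\infty}\sup_{|x|>\sigma}\frac{|\nabla W(x)|}{V(x)}=0$; (V6) for every compact $\mathcal K\subset\mathbb R^d$, $\sup_{x\in\mathcal K,\,y\in\mathbb R^d}\frac{V(y-x)}{1+V(y)}<\infty$. *)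

theory Defs
  imports "HOL-Analysis.Analysis"
begin

text \<open>
  Densities may take the value \<open>\<infinity>\<close> (mass may concentrate at the origin), so powers are taken in
  \<^typ>\<open>ennreal\<close>.  For a negative exponent, \<open>0\<close> is sent to \<open>\<infinity>\<close> and \<open>\<infinity>\<close> to \<open>0\<close>.
\<close>

definition enn_powr :: "ennreal \<Rightarrow> real \<Rightarrow> ennreal" where
  "enn_powr x a =
     (if a = 0 then 1
      else if x = 0 then (if a < 0 then \<infinity> else 0)
      else if x = \<infinity> then (if a < 0 then 0 else \<infinity>)
      else ennreal (enn2real x powr a))"

definition radial_on :: "'a::real_normed_vector set \<Rightarrow> ('a \<Rightarrow> 'b) \<Rightarrow> bool" where
  "radial_on S f \<longleftrightarrow> (\<forall>x\<in>S. \<forall>y\<in>S. norm x = norm y \<longrightarrow> f x = f y)"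

definition radially_increasing :: "('a::real_normed_vector \<Rightarrow> real) \<Rightarrow> bool" where
  "radially_increasing f \<longleftrightarrow> (\<forall>x y. norm x \<le> norm y \<longrightarrow> f x \<le> f y)"

definition grad :: "('a::euclidean_space \<Rightarrow> real) \<Rightarrow> 'a \<Rightarrow> 'a" where
  "grad f x = (THE g. GDERIV f x :> g)"

definition partial_deriv :: "'a::euclidean_space \<Rightarrow> ('a \<Rightarrow> real) \<Rightarrow> 'a \<Rightarrow> real" where
  "partial_deriv b f x = frechet_derivative f (at x) b"

definition laplacian :: "('a::euclidean_space \<Rightarrow> real) \<Rightarrow> 'a \<Rightarrow> real" where
  "laplacian f x = (\<Sum>b\<in>Basis. partial_deriv b (partial_deriv b f) x)"

fun C_class :: "nat \<Rightarrow> ('a::euclidean_space \<Rightarrow> real) \<Rightarrow> bool" where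
  "C_class 0 f \<longleftrightarrow> continuous_on UNIV f"
| "C_class (Suc k) f \<longleftrightarrow>
     (\<forall>x. f differentiable (at x)) \<and> (\<forall>b\<in>Basis. C_class k (partial_deriv b f))"

text \<open>\<open>C\<^sub>c\<^sup>\<infinity>(U)\<close>, its elements being extended by zero to the whole space.\<close>

definition Cc_infty :: "'a::euclidean_space set \<Rightarrow> ('a \<Rightarrow> real) set" where
  "Cc_infty U = {f. (\<forall>k. C_class k f) \<and> compact (closure {x. f x \<noteq> 0})
                    \<and> closure {x. f x \<noteq> 0} \<subseteq> U}"

definition quad_W :: "'a::euclidean_space \<Rightarrow> real" where
  "quad_W x = (norm x)\<^sup>2 / 2"

text \<open>Nonnegative absolutely continuous measures of mass \<open>a\<close>, represented by their densities.\<close>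

definition densities :: "real \<Rightarrow> ('a::euclidean_space \<Rightarrow> real) set" where
  "densities a = {\<rho>. \<rho> \<in> borel_measurable lebesgue \<and> (\<forall>x. 0 \<le> \<rho> x)
                     \<and> (\<integral>\<^sup>+x. ennreal (\<rho> x) \<partial>lebesgue) = ennreal a}"

text \<open>
  The energies below are used for \<open>0 < m < 1\<close> and \<open>V \<ge> 0\<close>: the diffusion term lies in \<open>[-\<infinity>, 0]\<close>
  and the other two in \<open>[0, \<infinity>]\<close>.  Since \<open>\<infinity> + (-\<infinity>) = \<infinity>\<close> in \<^typ>\<open>ereal\<close>, a density for which
  the sum is indeterminate has energy \<open>\<infinity>\<close> and does not contribute to an infimum.
\<close>

definition diffusion_energy :: "real \<Rightarrow> ('a::euclidean_space \<Rightarrow> real) \<Rightarrow> ereal" where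
  "diffusion_energy m \<rho> =
     ereal (1 / (m - 1)) * enn2ereal (\<integral>\<^sup>+x. ennreal (\<rho> x powr m) \<partial>lebesgue)"

definition potential_energy :: "('a::euclidean_space \<Rightarrow> real) \<Rightarrow> ('a \<Rightarrow> real) \<Rightarrow> ereal" where
  "potential_energy V \<rho> = enn2ereal (\<integral>\<^sup>+x. ennreal (V x * \<rho> x) \<partial>lebesgue)"

definition interaction_energy :: "('a::euclidean_space \<Rightarrow> real) \<Rightarrow> ('a \<Rightarrow> real) \<Rightarrow> ereal" where
  "interaction_energy W \<rho> =
     ereal (1 / 2) *
     enn2ereal (\<integral>\<^sup>+x. (\<integral>\<^sup>+y. ennreal (W (x - y) * \<rho> y * \<rho> x) \<partial>lebesgue) \<partial>lebesgue)"

definition hyp_V1 :: "real \<Rightarrow> ('a::euclidean_space \<Rightarrow> real) \<Rightarrow> bool" where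
  "hyp_V1 m V \<longleftrightarrow>
     (INF \<rho>\<in>densities 1. diffusion_energy m \<rho> + potential_energy V \<rho>) > - \<infinity>"

definition hyp_V2 :: "('a::euclidean_space \<Rightarrow> real) \<Rightarrow> bool" where
  "hyp_V2 V \<longleftrightarrow>
     (\<forall>x. V differentiable (at x)) \<and> (\<exists>C. \<forall>x. norm (grad V x) \<le> C * (1 + norm x))"

text \<open>The Laplacian of \<open>V\<close> is understood in the sense of distributions.\<close>

definition hyp_V3 :: "('a::euclidean_space \<Rightarrow> real) \<Rightarrow> bool" where
  "hyp_V3 V \<longleftrightarrow>
     (\<exists>g. g \<in> borel_measurable lebesgue \<and> (\<exists>C. AE x in lebesgue. \<bar>g x\<bar> \<le> C) \<and>
          (\<forall>\<phi>\<in>Cc_infty UNIV.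
             (\<integral>x. V x * laplacian \<phi> x \<partial>lebesgue) = (\<integral>x. g x * \<phi> x \<partial>lebesgue)))"

definition hyp_V4 ::
  "real \<Rightarrow> real \<Rightarrow> ('a::euclidean_space \<Rightarrow> real) \<Rightarrow> ('a \<Rightarrow> real) \<Rightarrow> bool" where
  "hyp_V4 m a W V \<longleftrightarrow>
     (\<exists>\<epsilon>. 0 < \<epsilon> \<and> \<epsilon> < 1 \<and>
        (INF \<rho>\<in>densities a.
            diffusion_energy m \<rho> + potential_energy V \<rho> + interaction_energy W \<rho>)
          \<ge> (INF \<rho>\<in>densities a. diffusion_energy m \<rho> + ereal (1 - \<epsilon>) * potential_energy V \<rho>) \<and>
        (INF \<rho>\<in>densities a. diffusion_energy m \<rho> + ereal (1 - \<epsilon>) * potential_energy V \<rho>) > - \<infinity>)"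

text \<open>The quotient is taken in \<^typ>\<open>ereal\<close>, so that a positive number divided by \<open>0\<close> is \<open>\<infinity>\<close>.\<close>

definition hyp_V5 :: "('a::euclidean_space \<Rightarrow> real) \<Rightarrow> ('a \<Rightarrow> real) \<Rightarrow> bool" where
  "hyp_V5 W V \<longleftrightarrow>
     ((\<lambda>\<sigma>::real. SUP x\<in>{x. norm x > \<sigma>}. ereal (norm (grad W x)) / ereal (V x)) \<longlongrightarrow> 0) at_top"

definition hyp_V6 :: "('a::euclidean_space \<Rightarrow> real) \<Rightarrow> bool" where
  "hyp_V6 V \<longleftrightarrow>
     (\<forall>K. compact K \<longrightarrow> (SUP x\<in>K. SUP y. ereal (V (y - x) / (1 + V y))) < \<infinity>)"

text \<open>
  The Euler--Lagrange equation on the open ball, at every point.  The integral term is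
  nonnegative, and the first term is \<open>-\<infinity>\<close> where \<open>\<rho>\<close> vanishes.
\<close>

definition euler_lagrange_on_ball ::
  "real \<Rightarrow> real \<Rightarrow> ('a::euclidean_space \<Rightarrow> real) \<Rightarrow> ('a \<Rightarrow> real) \<Rightarrow> ('a \<Rightarrow> real) \<Rightarrow> real
    \<Rightarrow> ('a \<Rightarrow> ennreal) \<Rightarrow> bool" where
  "euler_lagrange_on_ball m R V W \<eta> h \<rho> \<longleftrightarrow>
     (\<forall>x\<in>ball 0 R.
        ereal (- (m / (1 - m))) * enn2ereal (enn_powr (\<rho> x) (m - 1)) + ereal (V x)
        + enn2ereal (\<integral>\<^sup>+y. ennreal (\<eta> x * W (x - y) * \<eta> y) * \<rho> y \<partial>lebesgue_on (ball 0 R))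
        = ereal (- h))"

end

theory Submission
  imports Defs
begin

text \<open>
  Write \<open>w = \<eta> \<rho>\<close> and \<open>J x = \<integral> W (x - y) w y dy\<close>, so that the interaction term at \<open>x\<close> is
  \<open>\<eta> x * J x\<close>.  The equation at the origin, where \<open>V\<close> vanishes and \<open>\<eta> = 1\<close>, bounds the
  multiplier from below: \<open>\<rho> 0 powr (m - 1)\<close> is nonnegative, hence \<open>h \<ge> - J 0\<close>.  Inserting
  this into the equation at \<open>x\<close> gives
  \<open>m / (1 - m) * \<rho> x powr (m - 1) \<ge> V x + \<eta> x * J x - J 0\<close>.

  Two estimates on \<open>J\<close> remain.  Since \<open>w\<close> is radial, in particular even, and \<open>W\<close> is convex and
  even, \<open>J\<close> is smallest at the origin (\<open>nn_integral_convolution_minimal_at_0\<close>), so the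
  interaction terms contribute at least \<open>- (1 - \<eta> x) * J 0\<close>.  Since \<open>w\<close> has mass at most
  \<open>1\<close> and lives on the ball of radius \<open>R\<close>, \<open>J 0 \<le> R\<^sup>2 / 2\<close>.  The loss is therefore zero for
  \<open>norm x \<le> R / sqrt 2\<close>, and outside that ball it is at most \<open>R\<^sup>2 / 2 \<le> (norm x)\<^sup>2\<close>, which the
  quadratic part of \<open>V\<close> absorbs.  What survives is
  \<open>m / (1 - m) * \<rho> x powr (m - 1) \<ge> V0 x\<close>; the negative power \<open>- 1 / (1 - m)\<close> reverses the
  inequality and yields the pointwise bound, and integration yields the bound on the mass.
\<close>

lemma nn_integral_lebesgue_reflect:
  fixes f :: "'a::euclidean_space \<Rightarrow> ennreal"
  assumes f: "f \<in> borel_measurable lebesgue"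
  shows "(\<integral>\<^sup>+x. f (- x) \<partial>lebesgue) = (\<integral>\<^sup>+x. f x \<partial>lebesgue)"
proof -
  have T: "(\<lambda>x::'a. 0 + (\<Sum>j\<in>Basis. (- 1 * (x \<bullet> j)) *\<^sub>R j)) = uminus"
    by (simp add: sum_negf euclidean_representation)
  have eq: "lebesgue = density (distr lebesgue lebesgue (uminus :: 'a \<Rightarrow> 'a)) (\<lambda>_. 1)"
    using lebesgue_affine_euclidean[of "\<lambda>_. - 1" "0::'a"] unfolding T by simp
  have meas: "uminus \<in> (lebesgue :: 'a measure) \<rightarrow>\<^sub>M lebesgue"
    using lebesgue_affine_measurable[of "\<lambda>_. - 1" "0::'a"] unfolding T by simp
  have "(\<integral>\<^sup>+x. f x \<partial>lebesgue) =
        (\<integral>\<^sup>+x. f x \<partial>density (distr lebesgue lebesgue uminus) (\<lambda>_. 1))"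
    using eq by simp
  also have "\<dots> = (\<integral>\<^sup>+x. f x \<partial>distr lebesgue lebesgue uminus)"
    by (subst nn_integral_density) (use f in auto)
  also have "\<dots> = (\<integral>\<^sup>+x. f (- x) \<partial>lebesgue)"
    by (rule nn_integral_distr[OF meas]) (use f in simp)
  finally show ?thesis by simp
qed

lemma nn_integral_lebesgue_on_ball_reflect:
  fixes f :: "'a::euclidean_space \<Rightarrow> ennreal"
  assumes f: "f \<in> borel_measurable (lebesgue_on (ball 0 R))"
  shows "(\<integral>\<^sup>+x. f (- x) \<partial>lebesgue_on (ball 0 R)) = (\<integral>\<^sup>+x. f x \<partial>lebesgue_on (ball 0 R))"
proof -
  have "(\<lambda>x. f x * indicator (ball 0 R) x) \<in> borel_measurable lebesgue"
    using f by (subst (asm) borel_measurable_restrict_space_iff_ennreal) auto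
  from nn_integral_lebesgue_reflect[OF this] show ?thesis
    by (simp add: nn_integral_restrict_space indicator_def)
qed

text \<open>
  For an even weight, the convolution with a kernel \<open>K\<close> is even, so its value at \<open>x\<close> is the
  mean of its values at \<open>x\<close> and \<open>- x\<close>.  The hypothesis on \<open>K\<close> is midpoint convexity combined
  with evenness; it bounds this mean from below by the value at \<open>0\<close>.
\<close>

lemma nn_integral_convolution_minimal_at_0:
  fixes K :: "'a::euclidean_space \<Rightarrow> real" and w :: "'a \<Rightarrow> ennreal"
  assumes K_meas: "K \<in> borel_measurable borel" and K_nonneg: "\<And>x. 0 \<le> K x"
    and K_conv: "\<And>x y. 2 * K (0 - y) \<le> K (x - y) + K (x - - y)"
    and w_meas: "w \<in> borel_measurable (lebesgue_on (ball 0 R))"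
    and w_even: "\<And>y. y \<in> ball 0 R \<Longrightarrow> w (- y) = w y"
  shows "(\<integral>\<^sup>+y. ennreal (K (0 - y)) * w y \<partial>lebesgue_on (ball 0 R))
       \<le> (\<integral>\<^sup>+y. ennreal (K (x - y)) * w y \<partial>lebesgue_on (ball 0 R))"
    (is "?C \<le> ?D")
proof -
  let ?M = "lebesgue_on (ball 0 R) :: 'a measure"
  have cont_meas: "(\<lambda>y. ennreal (K (g y))) \<in> borel_measurable ?M"
    if "continuous_on UNIV g" for g :: "'a \<Rightarrow> 'a"
  proof -
    have "(\<lambda>y. ennreal (K (g y))) \<in> borel_measurable borel"
      using K_meas borel_measurable_continuous_onI[OF that] by measurable
    then show ?thesis
      by (intro measurable_restrict_space1 measurable_completion) simp
  qed
  have refl: "(\<integral>\<^sup>+y. ennreal (K (x - - y)) * w y \<partial>?M) = ?D"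
  proof -
    have "(\<integral>\<^sup>+y. ennreal (K (x - - y)) * w y \<partial>?M) =
          (\<integral>\<^sup>+y. ennreal (K (x - - y)) * w (- y) \<partial>?M)"
      by (rule nn_integral_cong) (simp add: w_even)
    also have "\<dots> = ?D"
      by (rule nn_integral_lebesgue_on_ball_reflect[of "\<lambda>y. ennreal (K (x - y)) * w y"])
        (intro borel_measurable_times_ennreal cont_meas w_meas continuous_intros)
    finally show ?thesis .
  qed
  have "2 * ?C = (\<integral>\<^sup>+y. 2 * (ennreal (K (0 - y)) * w y) \<partial>?M)"
    by (rule nn_integral_cmult[symmetric])
      (intro borel_measurable_times_ennreal cont_meas w_meas continuous_intros)
  also have "\<dots> \<le> (\<integral>\<^sup>+y. ennreal (K (x - y)) * w y + ennreal (K (x - - y)) * w y \<partial>?M)"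
  proof (rule nn_integral_mono)
    fix y
    have "2 * ennreal (K (0 - y)) = ennreal (2 * K (0 - y))"
      using K_nonneg by (simp add: ennreal_mult)
    also have "\<dots> \<le> ennreal (K (x - y) + K (x - - y))"
      by (rule ennreal_leI[OF K_conv])
    also have "\<dots> = ennreal (K (x - y)) + ennreal (K (x - - y))"
      using K_nonneg by simp
    finally have "2 * ennreal (K (0 - y)) * w y
        \<le> (ennreal (K (x - y)) + ennreal (K (x - - y))) * w y"
      by (rule mult_right_mono) simp
    then show "2 * (ennreal (K (0 - y)) * w y)
        \<le> ennreal (K (x - y)) * w y + ennreal (K (x - - y)) * w y"
      by (simp add: mult.assoc distrib_right)
  qed
  also have "\<dots> = ?D + (\<integral>\<^sup>+y. ennreal (K (x - - y)) * w y \<partial>?M)"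
    by (rule nn_integral_add)
      (intro borel_measurable_times_ennreal cont_meas w_meas continuous_intros)+
  also have "\<dots> = 2 * ?D"
    unfolding refl by (simp add: mult_2)
  finally show ?thesis
    by (simp add: ennreal_mult_le_mult_iff)
qed

text \<open>The parallelogram law: the two sides differ by \<open>(norm x)\<^sup>2\<close>.\<close>

lemma quad_W_midpoint:
  fixes x y :: "'a::euclidean_space"
  shows "2 * quad_W (0 - y) \<le> quad_W (x - y) + quad_W (x - - y)"
proof -
  have "(norm (x - y))\<^sup>2 + (norm (x - - y))\<^sup>2 = 2 * (norm x)\<^sup>2 + 2 * (norm y)\<^sup>2"
    by (simp add: power2_norm_eq_inner inner_diff_left inner_diff_right inner_add_left
        inner_add_right inner_commute)
  then have "quad_W (x - y) + quad_W (x - - y) = (norm x)\<^sup>2 + (norm y)\<^sup>2"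
    by (simp add: quad_W_def)
  moreover have "2 * quad_W (0 - y) = (norm y)\<^sup>2"
    by (simp add: quad_W_def)
  ultimately show ?thesis
    by simp
qed

text \<open>
  At the centre this is the bound \<open>R\<^sup>2 / 2\<close> on which the final estimate rests; elsewhere it serves
  to make the interaction term finite.
\<close>

lemma nn_integral_quad_W_le:
  fixes x :: "'a::euclidean_space"
  assumes w: "(\<integral>\<^sup>+y. w y \<partial>lebesgue_on (ball 0 R)) \<le> 1"
    and w_meas: "w \<in> borel_measurable (lebesgue_on (ball 0 R))"
  shows "(\<integral>\<^sup>+y. ennreal (quad_W (x - y)) * w y \<partial>lebesgue_on (ball 0 R)) \<le> ennreal ((norm x + R)\<^sup>2 / 2)"
proof -
  have "(\<integral>\<^sup>+y. ennreal (quad_W (x - y)) * w y \<partial>lebesgue_on (ball 0 R))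
      \<le> (\<integral>\<^sup>+y. ennreal ((norm x + R)\<^sup>2 / 2) * w y \<partial>lebesgue_on (ball 0 R))"
  proof (rule nn_integral_mono)
    fix y assume "y \<in> space (lebesgue_on (ball (0::'a) R))"
    then have "norm (x - y) \<le> norm x + R"
      using norm_triangle_ineq4[of x y] by simp
    then have "quad_W (x - y) \<le> (norm x + R)\<^sup>2 / 2"
      by (simp add: quad_W_def power_mono)
    then show "ennreal (quad_W (x - y)) * w y \<le> ennreal ((norm x + R)\<^sup>2 / 2) * w y"
      by (intro mult_right_mono ennreal_leI) auto
  qed
  also have "\<dots> = ennreal ((norm x + R)\<^sup>2 / 2) * (\<integral>\<^sup>+y. w y \<partial>lebesgue_on (ball 0 R))"
    by (rule nn_integral_cmult[OF w_meas])
  also have "\<dots> \<le> ennreal ((norm x + R)\<^sup>2 / 2)"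
    using mult_left_mono[OF w, of "ennreal ((norm x + R)\<^sup>2 / 2)"] by simp
  finally show ?thesis .
qed

text \<open>
  The map \<open>t \<mapsto> t powr (- 1 / (1 - m))\<close> is the decreasing inverse of \<open>t \<mapsto> t powr (m - 1)\<close>.
  The conventions at \<open>0\<close> and \<open>\<infinity>\<close> agree with this: for \<open>c = 0\<close> the bound is \<open>\<infinity>\<close>, and for \<open>c > 0\<close>
  the value \<open>r = \<infinity>\<close> is excluded, as its power is \<open>0\<close>.
\<close>

lemma le_enn_powr_inverse:
  assumes "m < 1" "0 \<le> c" "0 \<le> q" and q: "enn_powr r (m - 1) = ennreal q" and "c \<le> q"
  shows "r \<le> enn_powr (ennreal c) (- 1 / (1 - m))"
proof (cases "c = 0")
  case True
  then show ?thesis using \<open>m < 1\<close> by (simp add: enn_powr_def)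
next
  case False
  then have "0 < c" "0 < q" using assms by auto
  have "r \<noteq> 0" "r \<noteq> \<infinity>"
    using q \<open>m < 1\<close> \<open>0 < q\<close> by (auto simp: enn_powr_def)
  then obtain s where s: "r = ennreal s" "0 < s"
    by (cases r) (auto simp: less_le)
  have "ennreal (s powr (m - 1)) = ennreal q"
    using q s \<open>m < 1\<close> by (simp add: enn_powr_def)
  then have "s powr (m - 1) = q"
    using \<open>0 < q\<close> by (simp add: ennreal_inj)
  then have "(s powr (m - 1)) powr (- 1 / (1 - m)) \<le> c powr (- 1 / (1 - m))"
    using \<open>0 < c\<close> \<open>c \<le> q\<close> \<open>m < 1\<close>
    by (intro powr_mono2') (auto simp: divide_simps)
  moreover have "(m - 1) * (- 1 / (1 - m)) = 1"
    using \<open>m < 1\<close> by (simp add: field_simps)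
  ultimately have "s \<le> c powr (- 1 / (1 - m))"
    using s(2) by (simp add: powr_powr)
  then show ?thesis
    using s \<open>0 < c\<close> \<open>m < 1\<close> by (simp add: enn_powr_def ennreal_leI divide_simps)
qed

text \<open>
  Here \<open>p\<close> is the power of the density and \<open>i\<close> the interaction term. A density that satisfies the
  equation cannot vanish: \<open>p\<close> would be \<open>\<infinity>\<close> and the left-hand side \<open>- \<infinity>\<close>. So all terms are
  real.
\<close>

lemma euler_lagrange_real:
  assumes k: "0 < k" and i: "0 \<le> i"
    and eq: "ereal (- k) * enn2ereal p + ereal v + enn2ereal (ennreal i) = ereal (- h)"
  obtains q where "0 \<le> q" "p = ennreal q" "k * q = v + i + h"
proof (cases p)
  case (real q)
  then have "- (k * q) + v + i = - h"
    using eq i by (simp add: enn2ereal_ennreal)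
  then show ?thesis
    using that[of q] real by simp
next
  case top
  then show ?thesis
    using eq k i by (simp add: enn2ereal_ennreal top_ereal_def)
qed

theorem theorem7p1:
  fixes m R h a :: real
    and \<eta> V V0 :: "real ^ 'd \<Rightarrow> real"
    and \<rho> :: "real ^ 'd \<Rightarrow> ennreal"
  assumes "0 < m" "m < 1" "0 < R" "0 < a"
    and "\<eta> \<in> Cc_infty (ball 0 R)"
    and "radial_on UNIV \<eta>"
    and "\<And>x. 0 \<le> \<eta> x \<and> \<eta> x \<le> 1"
    and "\<And>x. norm x \<le> R / sqrt 2 \<Longrightarrow> \<eta> x = 1"
    and "\<And>x. 0 \<le> V x"
    and "radial_on UNIV V"
    and "radially_increasing V"
    and "hyp_V1 m V"
    and "hyp_V2 V"
    and "hyp_V3 V"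
    and "hyp_V4 m a quad_W V"
    and "hyp_V5 quad_W V"
    and "hyp_V6 V"
    and "V 0 = 0"
    and "\<And>x. 0 \<le> V0 x"
    and "\<And>x. V x \<ge> 2 * (norm x)\<^sup>2 + V0 x"
    and "\<rho> \<in> borel_measurable (lebesgue_on (ball 0 R))"
    and "radial_on (ball 0 R) \<rho>"
    and "(\<integral>\<^sup>+x. \<rho> x \<partial>lebesgue_on (ball 0 R)) \<le> 1"
    and "euler_lagrange_on_ball m R V quad_W \<eta> h \<rho>"
  shows "(\<forall>x\<in>ball 0 R. \<rho> x \<le> enn_powr (ennreal ((1 - m) / m * V0 x)) (- 1 / (1 - m)))
    \<and> ((\<integral>\<^sup>+x. enn_powr (ennreal ((1 - m) / m * V0 x)) (- 1 / (1 - m)) \<partial>lebesgue_on (ball 0 R)) < 1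
        \<longrightarrow> (\<integral>\<^sup>+x. \<rho> x \<partial>lebesgue_on (ball 0 R)) < 1)"
proof -
  note m = assms(1,2) and \<eta>01 = assms(7) and \<eta>1 = assms(8)
  let ?M = "lebesgue_on (ball 0 R) :: (real ^ 'd) measure"
  define w where "w y = ennreal (\<eta> y) * \<rho> y" for y
  define J where "J x = (\<integral>\<^sup>+y. ennreal (quad_W (x - y)) * w y \<partial>?M)" for x
  have "C_class 0 \<eta>"
    using assms(5) unfolding Cc_infty_def by blast
  then have "\<eta> \<in> borel_measurable borel"
    by (simp add: borel_measurable_continuous_onI)
  then have "(\<lambda>y. ennreal (\<eta> y)) \<in> borel_measurable borel"
    by measurable
  then have "(\<lambda>y. ennreal (\<eta> y)) \<in> borel_measurable ?M"
    by (intro measurable_restrict_space1 measurable_completion) simp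
  then have w_meas: "w \<in> borel_measurable ?M"
    unfolding w_def using assms(21) by (intro borel_measurable_times_ennreal)
  have w_even: "w (- y) = w y" if "y \<in> ball 0 R" for y
  proof -
    have "\<eta> (- y) = \<eta> y"
      using assms(6) unfolding radial_on_def by (metis UNIV_I norm_minus_cancel)
    moreover have "\<rho> (- y) = \<rho> y"
      using assms(22)[unfolded radial_on_def, rule_format, of "- y" y] that by simp
    ultimately show ?thesis by (simp add: w_def)
  qed
  have w_le: "w y \<le> \<rho> y" for y
    using mult_right_mono[of "ennreal (\<eta> y)" 1 "\<rho> y"] \<eta>01[of y] by (simp add: w_def)
  have w_mass: "(\<integral>\<^sup>+y. w y \<partial>?M) \<le> 1"
    by (rule order_trans[OF nn_integral_mono[OF w_le] assms(23)])
  have quad_meas: "(quad_W :: real ^ 'd \<Rightarrow> real) \<in> borel_measurable borel"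
    unfolding quad_W_def by (intro borel_measurable_continuous_onI continuous_intros) simp
  have quad_nonneg: "0 \<le> quad_W z" for z :: "real ^ 'd"
    by (simp add: quad_W_def)
  have J_min: "J 0 \<le> J x" for x
    unfolding J_def
    by (rule nn_integral_convolution_minimal_at_0[OF quad_meas quad_nonneg quad_W_midpoint
        w_meas w_even])
  have J0: "J 0 \<le> ennreal (R\<^sup>2 / 2)"
    using nn_integral_quad_W_le[where x = 0, OF w_mass w_meas] unfolding J_def by simp
  define j where "j x = enn2real (J x)" for x
  have Jj: "J x = ennreal (j x)" for x
  proof -
    have "J x \<le> ennreal ((norm x + R)\<^sup>2 / 2)"
      unfolding J_def by (rule nn_integral_quad_W_le[OF w_mass w_meas])
    also have "\<dots> < top" by simp
    finally show ?thesis
      unfolding j_def by (rule ennreal_enn2real[symmetric])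
  qed
  have j_nonneg: "0 \<le> j x" for x
    by (simp add: j_def)
  have j_min: "j 0 \<le> j x" for x
    using J_min[of x] j_nonneg by (simp add: Jj)
  have j0: "j 0 \<le> R\<^sup>2 / 2"
    using J0 by (simp add: Jj)
  have interaction: "(\<integral>\<^sup>+y. ennreal (\<eta> x * quad_W (x - y) * \<eta> y) * \<rho> y \<partial>?M) = ennreal (\<eta> x * j x)"
    for x
  proof -
    have "(\<integral>\<^sup>+y. ennreal (\<eta> x * quad_W (x - y) * \<eta> y) * \<rho> y \<partial>?M) =
          (\<integral>\<^sup>+y. ennreal (\<eta> x) * (ennreal (quad_W (x - y)) * w y) \<partial>?M)"
      using \<eta>01 quad_nonneg
      by (intro nn_integral_cong) (simp add: w_def ennreal_mult mult.assoc)
    also have "\<dots> = ennreal (\<eta> x) * J x"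
    proof -
      have "(\<lambda>y. ennreal (quad_W (x - y))) \<in> borel_measurable borel"
        using quad_meas by measurable
      then have "(\<lambda>y. ennreal (quad_W (x - y))) \<in> borel_measurable ?M"
        by (intro measurable_restrict_space1 measurable_completion) simp
      then show ?thesis
        unfolding J_def by (intro nn_integral_cmult borel_measurable_times_ennreal w_meas)
    qed
    finally show ?thesis
      using \<eta>01[of x] j_nonneg by (simp add: Jj ennreal_mult)
  qed
  have EL: "\<exists>q\<ge>0. enn_powr (\<rho> x) (m - 1) = ennreal q \<and> m / (1 - m) * q = V x + \<eta> x * j x + h"
    if "x \<in> ball 0 R" for x
  proof -
    have k: "0 < m / (1 - m)"
      using m by simp
    have i: "0 \<le> \<eta> x * j x"
      using \<eta>01[of x] j_nonneg[of x] by simp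
    have eq: "ereal (- (m / (1 - m))) * enn2ereal (enn_powr (\<rho> x) (m - 1)) + ereal (V x)
        + enn2ereal (ennreal (\<eta> x * j x)) = ereal (- h)"
      using assms(24) that unfolding euler_lagrange_on_ball_def interaction by blast
    from euler_lagrange_real[OF k i eq] show ?thesis by blast
  qed
  have h: "- j 0 \<le> h"
  proof -
    obtain q where "0 \<le> q" "m / (1 - m) * q = V 0 + \<eta> 0 * j 0 + h"
      using EL[of 0] \<open>0 < R\<close> by auto
    moreover have "0 \<le> m / (1 - m) * q"
      using m \<open>0 \<le> q\<close> by simp
    ultimately show ?thesis
      using \<eta>1[of 0] \<open>0 < R\<close> \<open>V 0 = 0\<close> by simp
  qed
  have bound: "\<rho> x \<le> enn_powr (ennreal ((1 - m) / m * V0 x)) (- 1 / (1 - m))"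
    if x: "x \<in> ball 0 R" for x
  proof -
    obtain q where q: "0 \<le> q" "enn_powr (\<rho> x) (m - 1) = ennreal q"
      and eq: "m / (1 - m) * q = V x + \<eta> x * j x + h"
      using EL[OF x] by auto
    have loss: "(1 - \<eta> x) * j 0 \<le> 2 * (norm x)\<^sup>2"
    proof (cases "norm x \<le> R / sqrt 2")
      case True
      then show ?thesis using \<eta>1[of x] by simp
    next
      case False
      then have "(R / sqrt 2)\<^sup>2 \<le> (norm x)\<^sup>2"
        using \<open>0 < R\<close> by (intro power_mono) auto
      then have "R\<^sup>2 / 2 \<le> (norm x)\<^sup>2"
        by (simp add: power_divide)
      moreover have "(1 - \<eta> x) * j 0 \<le> j 0"
        using \<eta>01[of x] j_nonneg[of 0] by (simp add: mult_left_le_one_le)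
      moreover have "0 \<le> (norm x)\<^sup>2" by simp
      ultimately show ?thesis using j0 by linarith
    qed
    have "\<eta> x * j 0 \<le> \<eta> x * j x"
      using j_min[of x] \<eta>01[of x] by (simp add: mult_left_mono)
    then have "V0 x \<le> m / (1 - m) * q"
      using eq h loss assms(20)[of x] by (simp add: left_diff_distrib)
    then have "(1 - m) / m * V0 x \<le> q"
      using m by (simp add: field_simps)
    moreover have "0 \<le> (1 - m) / m * V0 x"
      using m assms(19)[of x] by simp
    ultimately show ?thesis
      by (intro le_enn_powr_inverse[OF m(2) _ q])
  qed
  then have "(\<integral>\<^sup>+x. \<rho> x \<partial>?M) \<le>
      (\<integral>\<^sup>+x. enn_powr (ennreal ((1 - m) / m * V0 x)) (- 1 / (1 - m)) \<partial>?M)"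
    by (intro nn_integral_mono) simp
  with bound show ?thesis
    by (auto intro: le_less_trans)
qed

end
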